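(* The completion of a cofinite graph $\Gamma$ is unique up to an isomorphism extending the identity map on $\Gamma$: if $\Gamma_0$ and $\Gamma_1$ are two completions of $\Gamma$, then there is an isomorphism of topological graphs (a graph isomorphism that is a homeomorphism) $f\colon\Gamma_0\to\Gamma_1$ such that $f(x)=x$ for all $x\in\Gamma$.
   Context: A graph is a set $\Gamma$ partitioned into subsets $V(\Gamma)$ (vertices) and $E(\Gamma)$ (edges), with maps $s,t\colon E(\Gamma)\to V(\Gamma)$ and $e\mapsto\overline e$, $E(\Gamma)\to E(\Gamma)$, such that $\overline e\ne e$, $\overline{\overline e}=e$, $t(\overline e)=s(e)$, $s(\overline e)=t(e)$ for all edges $e$. A map of graphs sends vertices to vertices and edges to edges and preserves $s$, $t$ and edge inversion; a graph isomorphism is a bijective map of graphs. A subgraph is a subset closed under $s$, $t$ and edge inversion, with the restricted structure maps. A topological graph is a graph with a topology such that $V(\Gamma),E(\Gamma)$ are closed, $s,t$ and edge inversion are continuous, and which admits an orientation, i.e. a closed subset $E^+(\Gamma)\subseteq E(\Gamma)$ containing exactly one edge of each pair $\{e,\overline e\}$. An equivalence relation $R$ on a graph $\Gamma$ is compatible if: (1) $R=R_V\cup R_E$, where $R_V,R_E$ are equivalence relations on $V(\Gamma),E(\Gamma)$ (the restrictions of $R$); (2) $(e_1,e_2)\in R$ for edges $e_1,e_2$ implies $(s(e_1),s(e_2)),(t(e_1),t(e_2)),(\overline{e_1},\overline{e_2})\in R$; (3) $(e,\overline e)\notin R$ for all $e\in E(\Gamma)$. A cofinite entourage of a uniform space $X$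 is an entourage $R$ that is an equivalence relation on $X$ such that the quotient space $X/R$ is a finite discrete space. A cofinite graph is an abstract graph $\Gamma$ endowed with a Hausdorff uniformity such that every entourage of $\Gamma$ contains a compatible cofinite entourage; its topology is the one induced by the uniformity. A completion of a cofinite graph $\Gamma$ is any compact Hausdorff topological graph $\overline\Gamma$ that contains $\Gamma$ as a dense subgraph.
   Formalization: A completion is required to induce the given uniformity of Γ (from its unique compatible uniformity), not merely to contain Γ as a dense subgraph; otherwise discrete ℕ with the finite-partition uniformity would have both its one-point and Stone–Čech compactifications as completions. *)

theory Defs
  imports "HOL-Analysis.Abstract_Topological_Spaces"
begin

section \<open>Graphs\<close>

text \<open>A graph is a single set, its set of points, partitioned into vertices and edges; both
  live in the same type.  The structure maps are only meaningful on edges.\<close>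

record 'a sgraph =
  verts :: "'a set"
  edges :: "'a set"
  src :: "'a \<Rightarrow> 'a"
  tgt :: "'a \<Rightarrow> 'a"
  bar :: "'a \<Rightarrow> 'a"

definition points :: "'a sgraph \<Rightarrow> 'a set" where
  "points G = verts G \<union> edges G"

definition is_graph :: "'a sgraph \<Rightarrow> bool" where
  "is_graph G \<longleftrightarrow>
     verts G \<inter> edges G = {} \<and>
     (\<forall>e\<in>edges G. src G e \<in> verts G \<and> tgt G e \<in> verts G \<and> bar G e \<in> edges G \<and>
        bar G e \<noteq> e \<and> bar G (bar G e) = e \<and>
        tgt G (bar G e) = src G e \<and> src G (bar G e) = tgt G e)"

definition graph_map :: "'a sgraph \<Rightarrow> 'b sgraph \<Rightarrow> ('a \<Rightarrow> 'b) \<Rightarrow> bool" where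
  "graph_map G H f \<longleftrightarrow>
     f ` verts G \<subseteq> verts H \<and> f ` edges G \<subseteq> edges H \<and>
     (\<forall>e\<in>edges G. f (src G e) = src H (f e) \<and> f (tgt G e) = tgt H (f e) \<and>
        f (bar G e) = bar H (f e))"

definition graph_iso :: "'a sgraph \<Rightarrow> 'b sgraph \<Rightarrow> ('a \<Rightarrow> 'b) \<Rightarrow> bool" where
  "graph_iso G H f \<longleftrightarrow> graph_map G H f \<and> bij_betw f (points G) (points H)"

text \<open>Closure of the subset under the structure maps is contained in \<open>is_graph H\<close>.\<close>

definition subgraph :: "'a sgraph \<Rightarrow> 'a sgraph \<Rightarrow> bool" where
  "subgraph H G \<longleftrightarrow>
     is_graph H \<and> is_graph G \<and> verts H \<subseteq> verts G \<and> edges H \<subseteq> edges G \<and>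
     (\<forall>e\<in>edges H. src H e = src G e \<and> tgt H e = tgt G e \<and> bar H e = bar G e)"

definition orientation :: "'a sgraph \<Rightarrow> 'a set \<Rightarrow> bool" where
  "orientation G P \<longleftrightarrow> P \<subseteq> edges G \<and> (\<forall>e\<in>edges G. (e \<in> P) \<noteq> (bar G e \<in> P))"

definition topological_graph :: "'a sgraph \<Rightarrow> 'a topology \<Rightarrow> bool" where
  "topological_graph G T \<longleftrightarrow>
     is_graph G \<and> topspace T = points G \<and>
     closedin T (verts G) \<and> closedin T (edges G) \<and>
     continuous_map (subtopology T (edges G)) (subtopology T (verts G)) (src G) \<and>
     continuous_map (subtopology T (edges G)) (subtopology T (verts G)) (tgt G) \<and>
     continuous_map (subtopology T (edges G)) (subtopology T (edges G)) (bar G) \<and>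
     (\<exists>P. closedin T P \<and> orientation G P)"


section \<open>Uniformities on a set, given by their entourages\<close>

definition uniform_structure :: "'a set \<Rightarrow> ('a \<times> 'a) set set \<Rightarrow> bool" where
  "uniform_structure X U \<longleftrightarrow>
     X \<times> X \<in> U \<and>
     (\<forall>E\<in>U. E \<subseteq> X \<times> X \<and> Id_on X \<subseteq> E \<and> E\<inverse> \<in> U \<and> (\<exists>D\<in>U. D O D \<subseteq> E)) \<and>
     (\<forall>D\<in>U. \<forall>E\<in>U. D \<inter> E \<in> U) \<and>
     (\<forall>D\<in>U. \<forall>E. D \<subseteq> E \<and> E \<subseteq> X \<times> X \<longrightarrow> E \<in> U)"

definition uniform_topology :: "'a set \<Rightarrow> ('a \<times> 'a) set set \<Rightarrow> 'a topology" where
  "uniform_topology X U = topology (\<lambda>S. S \<subseteq> X \<and> (\<forall>x\<in>S. \<exists>E\<in>U. E `` {x} \<subseteq> S))"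

lemma openin_uniform_topology:
  assumes "uniform_structure X U"
  shows "openin (uniform_topology X U) S \<longleftrightarrow> S \<subseteq> X \<and> (\<forall>x\<in>S. \<exists>E\<in>U. E `` {x} \<subseteq> S)"
proof -
  have "\<forall>D\<in>U. \<forall>E\<in>U. D \<inter> E \<in> U"
    using assms unfolding uniform_structure_def by (elim conjE)
  then have inter: "D \<inter> E \<in> U" if "D \<in> U" "E \<in> U" for D E
    using that by blast
  define P where "P S \<longleftrightarrow> S \<subseteq> X \<and> (\<forall>x\<in>S. \<exists>E\<in>U. E `` {x} \<subseteq> S)" for S
  have PI: "P S" if "S \<subseteq> X" "\<And>x. x \<in> S \<Longrightarrow> \<exists>E\<in>U. E `` {x} \<subseteq> S" for S
    unfolding P_def by (intro conjI ballI that)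
  have PD1: "S \<subseteq> X" if "P S" for S
    using that unfolding P_def by (rule conjunct1)
  have PD2: "\<exists>E\<in>U. E `` {x} \<subseteq> S" if "P S" "x \<in> S" for S x
    using that(1) unfolding P_def by (rule conjunct2[THEN bspec, OF _ that(2)])
  have 1: "P (S \<inter> T)" if S: "P S" and T: "P T" for S T
  proof (rule PI)
    show "S \<inter> T \<subseteq> X" using PD1[OF S] by (rule le_infI1)
    fix x assume x: "x \<in> S \<inter> T"
    obtain D where D: "D \<in> U" "D `` {x} \<subseteq> S" using PD2[OF S IntD1[OF x]] by (rule bexE)
    obtain E where E: "E \<in> U" "E `` {x} \<subseteq> T" using PD2[OF T IntD2[OF x]] by (rule bexE)
    have "(D \<inter> E) `` {x} \<subseteq> S \<inter> T" using D(2) E(2) by fast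
    then show "\<exists>E\<in>U. E `` {x} \<subseteq> S \<inter> T" using inter[OF D(1) E(1)] by (rule bexI)
  qed
  have 2: "P (\<Union>K)" if K: "\<forall>S\<in>K. P S" for K
  proof (rule PI)
    show "\<Union>K \<subseteq> X" using PD1 K by (intro Union_least) simp
    fix x assume "x \<in> \<Union>K"
    then obtain S where S: "S \<in> K" "x \<in> S" by (rule UnionE)
    obtain E where E: "E \<in> U" "E `` {x} \<subseteq> S" using PD2[OF bspec[OF K S(1)] S(2)] by (rule bexE)
    have "E `` {x} \<subseteq> \<Union>K" using E(2) Union_upper[OF S(1)] by (rule subset_trans)
    then show "\<exists>E\<in>U. E `` {x} \<subseteq> \<Union>K" using E(1) by (rule bexI)
  qed
  have "istopology P" unfolding istopology_def by (intro conjI allI impI 1 2)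
  then have "openin (topology P) = P" by (rule topology_inverse')
  moreover have "uniform_topology X U = topology P"
    unfolding uniform_topology_def P_def by (rule refl)
  ultimately have "openin (uniform_topology X U) S = P S" by simp
  then show ?thesis unfolding P_def .
qed

lemma topspace_uniform_topology:
  assumes "uniform_structure X U"
  shows "topspace (uniform_topology X U) = X"
proof (rule subset_antisym)
  show "topspace (uniform_topology X U) \<subseteq> X"
    using openin_topspace[of "uniform_topology X U"]
    unfolding openin_uniform_topology[OF assms] by (rule conjunct1)
  have "X \<times> X \<in> U" using assms unfolding uniform_structure_def by (rule conjunct1)
  moreover have "(X \<times> X) `` {x} \<subseteq> X" for x by fast
  ultimately have "openin (uniform_topology X U) X"
    unfolding openin_uniform_topology[OF assms] by (intro conjI ballI subset_refl bexI[of _ "X \<times> X"])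
  then show "X \<subseteq> topspace (uniform_topology X U)" by (rule openin_subset)
qed

definition subspace_uniformity :: "'a set \<Rightarrow> ('a \<times> 'a) set set \<Rightarrow> ('a \<times> 'a) set set" where
  "subspace_uniformity Y U = (\<lambda>E. E \<inter> Y \<times> Y) ` U"

text \<open>The quotient-map clause says that \<open>X // R\<close> with the quotient topology is discrete.\<close>

definition cofinite_entourage ::
    "'a set \<Rightarrow> ('a \<times> 'a) set set \<Rightarrow> ('a \<times> 'a) set \<Rightarrow> bool" where
  "cofinite_entourage X U R \<longleftrightarrow>
     R \<in> U \<and> equiv X R \<and> finite (X // R) \<and>
     quotient_map (uniform_topology X U) (discrete_topology (X // R)) (\<lambda>x. R `` {x})"


section \<open>Cofinite graphs and their completions\<close>

definition compatible :: "'a sgraph \<Rightarrow> ('a \<times> 'a) set \<Rightarrow> bool" where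
  "compatible G R \<longleftrightarrow>
     equiv (points G) R \<and>
     (\<exists>R\<^sub>V R\<^sub>E. equiv (verts G) R\<^sub>V \<and> equiv (edges G) R\<^sub>E \<and> R = R\<^sub>V \<union> R\<^sub>E) \<and>
     (\<forall>e\<^sub>1\<in>edges G. \<forall>e\<^sub>2\<in>edges G. (e\<^sub>1, e\<^sub>2) \<in> R \<longrightarrow>
        (src G e\<^sub>1, src G e\<^sub>2) \<in> R \<and> (tgt G e\<^sub>1, tgt G e\<^sub>2) \<in> R \<and> (bar G e\<^sub>1, bar G e\<^sub>2) \<in> R) \<and>
     (\<forall>e\<in>edges G. (e, bar G e) \<notin> R)"

definition cofinite_graph :: "'a sgraph \<Rightarrow> ('a \<times> 'a) set set \<Rightarrow> bool" where
  "cofinite_graph G U \<longleftrightarrow>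
     is_graph G \<and> uniform_structure (points G) U \<and>
     Hausdorff_space (uniform_topology (points G) U) \<and>
     (\<forall>E\<in>U. \<exists>R\<subseteq>E. compatible G R \<and> cofinite_entourage (points G) U R)"

text \<open>A completion contains \<open>G\<close> as a uniform subspace: the uniformity \<open>U\<close> of \<open>G\<close> is the one
  induced by the (unique) uniformity \<open>W\<close> that defines the compact Hausdorff topology \<open>T\<close>.
  It is not enough that \<open>T\<close> induce the topology of \<open>G\<close>: an infinite discrete set of
  vertices has many inequivalent Hausdorff compactifications.\<close>

definition graph_completion ::
    "'a sgraph \<Rightarrow> ('a \<times> 'a) set set \<Rightarrow> 'a sgraph \<Rightarrow> 'a topology \<Rightarrow> bool" where
  "graph_completion G U H T \<longleftrightarrow>
     topological_graph H T \<and> compact_space T \<and> Hausdorff_space T \<and>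
     subgraph G H \<and> T closure_of (points G) = topspace T \<and>
     (\<exists>W. uniform_structure (points H) W \<and> uniform_topology (points H) W = T \<and>
        subspace_uniformity (points G) W = U)"

end

theory Submission
  imports Defs
begin

text \<open>A compact Hausdorff space containing \<open>X\<close> as a dense uniform subspace is determined by the
  uniformity of \<open>X\<close>.  Given two such spaces, take the closure \<open>K\<close> of the diagonal of \<open>X\<close> in their
  product.  Both projections of \<open>K\<close> are onto, since their images are compact, hence closed, and
  contain the dense set \<open>X\<close>.  Both are injective: if \<open>(a, b)\<close> and \<open>(a, c)\<close> lie in \<open>K\<close>, then \<open>b\<close>
  and \<open>c\<close> are limits of points of \<open>X\<close> that approach \<open>a\<close> in the first space; such points are
  close to each other for the uniformity induced on \<open>X\<close>, which is the same on both sides, so \<open>b\<close>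
  and \<open>c\<close> cannot be separated (\<open>common_approximation_unique\<close>).  Continuous bijections from a compact
  space to a Hausdorff space are homeomorphisms, so \<open>K\<close> is the graph of a homeomorphism \<open>f\<close> fixing
  \<open>X\<close> pointwise (\<open>dense_uniform_subspace_homeomorphic\<close>).

  For completions of a graph \<open>\<Gamma>\<close>, the vertex set and the edge set of a completion are closed and
  disjoint, so they are exactly the closures of the vertex set and the edge set of \<open>\<Gamma>\<close>; hence \<open>f\<close>
  maps vertices to vertices and edges to edges.  Finally \<open>f\<close> commutes with the structure maps on the
  edges of \<open>\<Gamma>\<close>, where it is the identity, and therefore by continuity on all edges.\<close>

section \<open>Entourages as neighbourhoods\<close>

lemma uniform_structureD:
  assumes "uniform_structure X U"
  shows "E \<in> U \<Longrightarrow> E \<subseteq> X \<times> X"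
    and "E \<in> U \<Longrightarrow> x \<in> X \<Longrightarrow> (x, x) \<in> E"
    and "E \<in> U \<Longrightarrow> E\<inverse> \<in> U"
    and "E \<in> U \<Longrightarrow> \<exists>D\<in>U. D O D \<subseteq> E"
    and "D \<in> U \<Longrightarrow> E \<in> U \<Longrightarrow> D \<inter> E \<in> U"
proof -
  have *: "\<forall>E\<in>U. E \<subseteq> X \<times> X \<and> Id_on X \<subseteq> E \<and> E\<inverse> \<in> U \<and> (\<exists>D\<in>U. D O D \<subseteq> E)"
    using assms unfolding uniform_structure_def by (elim conjE)
  have **: "\<forall>D\<in>U. \<forall>E\<in>U. D \<inter> E \<in> U"
    using assms unfolding uniform_structure_def by (elim conjE)
  show "E \<in> U \<Longrightarrow> E \<subseteq> X \<times> X" "E \<in> U \<Longrightarrow> E\<inverse> \<in> U" "E \<in> U \<Longrightarrow> \<exists>D\<in>U. D O D \<subseteq> E"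
    using * by simp_all
  show "E \<in> U \<Longrightarrow> x \<in> X \<Longrightarrow> (x, x) \<in> E" using * by blast
  show "D \<in> U \<Longrightarrow> E \<in> U \<Longrightarrow> D \<inter> E \<in> U" using ** by simp
qed

lemma symmetric_half_entourage:
  assumes U: "uniform_structure X U" and "E \<in> U"
  obtains D where "D \<in> U" "sym D" "D O D \<subseteq> E"
proof -
  obtain D where D: "D \<in> U" "D O D \<subseteq> E"
    using uniform_structureD(4)[OF assms] by blast
  show thesis
  proof
    show "D \<inter> D\<inverse> \<in> U" using U D(1) by (simp add: uniform_structureD)
    show "sym (D \<inter> D\<inverse>)" by (rule sym_Int_converse)
    show "(D \<inter> D\<inverse>) O (D \<inter> D\<inverse>) \<subseteq> E" using D(2) by blast
  qed
qed

text \<open>The interior of \<open>E `` {x}\<close> consists of the points around which some entourage stays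
  inside; it is open because that entourage can be halved.\<close>

lemma entourage_contains_open:
  assumes U: "uniform_structure X U" and E: "E \<in> U" and x: "x \<in> X"
  obtains V where "openin (uniform_topology X U) V" "x \<in> V" "V \<subseteq> E `` {x}"
proof
  let ?V = "{y \<in> X. \<exists>D\<in>U. D `` {y} \<subseteq> E `` {x}}"
  have "\<exists>D\<in>U. D `` {y} \<subseteq> ?V" if y: "y \<in> ?V" for y
  proof -
    obtain D where D: "D \<in> U" "D `` {y} \<subseteq> E `` {x}" using y by blast
    obtain F where F: "F \<in> U" "F O F \<subseteq> D"
      using uniform_structureD(4)[OF U D(1)] by blast
    have "F `` {y} \<subseteq> ?V"
    proof
      fix z assume z: "z \<in> F `` {y}"
      then have "F `` {z} \<subseteq> D `` {y}" using F(2) by blast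
      then have "F `` {z} \<subseteq> E `` {x}" using D(2) by (rule subset_trans)
      moreover have "z \<in> X" using z uniform_structureD(1)[OF U F(1)] by blast
      ultimately show "z \<in> ?V" using F(1) by blast
    qed
    then show ?thesis using F(1) by (rule bexI)
  qed
  then show "openin (uniform_topology X U) ?V"
    unfolding openin_uniform_topology[OF U] by (intro conjI ballI) (rule Collect_subset)
  show "x \<in> ?V" using E x by blast
  show "?V \<subseteq> E `` {x}"
  proof
    fix y assume "y \<in> ?V"
    then obtain D where "D \<in> U" "D `` {y} \<subseteq> E `` {x}" "y \<in> X" by blast
    then show "y \<in> E `` {x}" using uniform_structureD(2)[OF U] by blast
  qed
qed

lemma Hausdorff_entourages_separate:
  assumes U: "uniform_structure X U" and H: "Hausdorff_space (uniform_topology X U)"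
    and "x \<in> X" "y \<in> X" and close: "\<And>E. E \<in> U \<Longrightarrow> (x, y) \<in> E"
  shows "x = y"
proof (rule ccontr)
  assume "x \<noteq> y"
  then obtain V W where V: "openin (uniform_topology X U) V" "x \<in> V" "y \<in> W" "disjnt V W"
    using H assms(3,4) topspace_uniform_topology[OF U] unfolding Hausdorff_space_def by metis
  then obtain E where "E \<in> U" "E `` {x} \<subseteq> V"
    unfolding openin_uniform_topology[OF U] by blast
  then have "y \<in> V" using close by blast
  then show False using V by (auto simp: disjnt_iff)
qed

section \<open>Uniqueness of compact Hausdorff hulls\<close>

text \<open>If \<open>x\<close> and \<open>y\<close> in \<open>X\<close> are both near \<open>a\<close>, they are near each other in \<open>A\<close>, hence also
  in \<open>B\<close>, where \<open>x\<close> is near \<open>b\<close> and \<open>y\<close> is near \<open>c\<close>.\<close>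

lemma common_approximation_unique:
  assumes V: "uniform_structure A V" and W: "uniform_structure B W"
    and H: "Hausdorff_space (uniform_topology B W)"
    and X: "X \<subseteq> B"
    and VW: "subspace_uniformity X V = subspace_uniformity X W"
    and bc: "b \<in> B" "c \<in> B"
    and ab: "\<And>D E. D \<in> V \<Longrightarrow> E \<in> W \<Longrightarrow> \<exists>x\<in>X. (a, x) \<in> D \<and> (b, x) \<in> E"
    and ac: "\<And>D E. D \<in> V \<Longrightarrow> E \<in> W \<Longrightarrow> \<exists>x\<in>X. (a, x) \<in> D \<and> (c, x) \<in> E"
  shows "b = c"
proof (rule Hausdorff_entourages_separate[OF W H bc])
  fix E assume "E \<in> W"
  then obtain F where F: "F \<in> W" "F O F \<subseteq> E"
    using symmetric_half_entourage[OF W] by metis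
  then obtain G where G: "G \<in> W" "sym G" "G O G \<subseteq> F"
    using symmetric_half_entourage[OF W] by metis
  have "G \<inter> X \<times> X \<in> subspace_uniformity X V"
    using G(1) VW unfolding subspace_uniformity_def by blast
  then obtain D where D: "D \<in> V" "G \<inter> X \<times> X = D \<inter> X \<times> X"
    unfolding subspace_uniformity_def by blast
  obtain C where C: "C \<in> V" "sym C" "C O C \<subseteq> D"
    using symmetric_half_entourage[OF V D(1)] by metis
  obtain x where x: "x \<in> X" "(a, x) \<in> C" "(b, x) \<in> G" using ab[OF C(1) G(1)] by blast
  obtain y where y: "y \<in> X" "(a, y) \<in> C" "(c, y) \<in> G" using ac[OF C(1) G(1)] by blast
  have "(x, y) \<in> G" using x y C D(2) by (blast dest: symD)
  then have "(b, y) \<in> F" using x(3) G(3) by blast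
  moreover have "(y, c) \<in> F"
    using y(3) G uniform_structureD(2)[OF W G(1) bc(2)] by (blast dest: symD)
  ultimately show "(b, c) \<in> E" using F(2) by blast
qed

text \<open>This translates membership in the closure of the diagonal into the language of entourages.\<close>

lemma closure_of_diagonal_approximation:
  assumes V: "uniform_structure A V" and W: "uniform_structure B W"
    and ab: "(a, b) \<in> prod_topology (uniform_topology A V) (uniform_topology B W)
      closure_of ((\<lambda>x. (x, x)) ` X)"
    and D: "D \<in> V" and E: "E \<in> W"
  shows "\<exists>x\<in>X. (a, x) \<in> D \<and> (b, x) \<in> E"
proof -
  have "a \<in> A" "b \<in> B"
    using ab by (auto simp: in_closure_of topspace_uniform_topology V W)
  obtain M where M: "openin (uniform_topology A V) M" "a \<in> M" "M \<subseteq> D `` {a}"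
    using entourage_contains_open[OF V D \<open>a \<in> A\<close>] by metis
  obtain N where N: "openin (uniform_topology B W) N" "b \<in> N" "N \<subseteq> E `` {b}"
    using entourage_contains_open[OF W E \<open>b \<in> B\<close>] by metis
  have "openin (prod_topology (uniform_topology A V) (uniform_topology B W)) (M \<times> N)"
    using M N by (simp add: openin_prod_Times_iff)
  moreover have "(a, b) \<in> M \<times> N" using M(2) N(2) by blast
  ultimately obtain p where "p \<in> (\<lambda>x. (x, x)) ` X" "p \<in> M \<times> N"
    using ab unfolding in_closure_of by metis
  then obtain x where "x \<in> X" "x \<in> M" "x \<in> N" by blast
  then show ?thesis using M N by blast
qed

lemma compact_image_contains_dense:
  assumes f: "continuous_map S T f" and S: "compact_space S" and T: "Hausdorff_space T"
    and X: "X \<subseteq> f ` topspace S" and dense: "T closure_of X = topspace T"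
  shows "f ` topspace S = topspace T"
proof
  show "f ` topspace S \<subseteq> topspace T" using f by (rule continuous_map_image_subset_topspace)
  have "closedin T (f ` topspace S)"
    using f S T by (meson compact_space_def compactin_imp_closedin image_compactin)
  then show "topspace T \<subseteq> f ` topspace S"
    using closure_of_minimal[OF X, of T] dense by simp
qed

theorem dense_uniform_subspace_homeomorphic:
  assumes V: "uniform_structure A V" and W: "uniform_structure B W"
    and S: "S = uniform_topology A V" "compact_space S" "Hausdorff_space S"
    and T: "T = uniform_topology B W" "compact_space T" "Hausdorff_space T"
    and X: "X \<subseteq> A" "X \<subseteq> B"
    and dense: "S closure_of X = topspace S" "T closure_of X = topspace T"
    and VW: "subspace_uniformity X V = subspace_uniformity X W"
  obtains f where "homeomorphic_map S T f" "\<And>x. x \<in> X \<Longrightarrow> f x = x"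
proof -
  define K where "K = prod_topology S T closure_of ((\<lambda>x. (x, x)) ` X)"
  define Q where "Q = subtopology (prod_topology S T) K"
  have AB: "topspace S = A" "topspace T = B"
    using V W S(1) T(1) by (simp_all add: topspace_uniform_topology)
  have K: "K \<subseteq> A \<times> B"
    using closure_of_subset_topspace[of "prod_topology S T"] AB by (simp add: K_def)
  then have Q: "topspace Q = K" using AB by (auto simp: Q_def)
  have diag: "(x, x) \<in> K" if "x \<in> X" for x
    using that X AB closure_of_subset[of "(\<lambda>x. (x, x)) ` X" "prod_topology S T"]
    by (auto simp: K_def)
  have approx: "\<exists>x\<in>X. (a, x) \<in> D \<and> (b, x) \<in> E" if "(a, b) \<in> K" "D \<in> V" "E \<in> W" for a b D E
    using closure_of_diagonal_approximation[OF V W _ that(2,3)] that(1)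
    by (simp add: K_def S(1) T(1))
  have compact: "compact_space Q"
    unfolding Q_def
  proof (intro compact_space_subtopology closedin_compact_space)
    show "closedin (prod_topology S T) K" by (simp add: K_def)
    show "compact_space (prod_topology S T)" using S T by (simp add: compact_space_prod_topology)
  qed
  have fst: "continuous_map Q S fst" and snd: "continuous_map Q T snd"
    unfolding Q_def by (intro continuous_map_from_subtopology continuous_map_fst continuous_map_snd)+
  have "homeomorphic_map Q S fst"
  proof (rule continuous_imp_homeomorphic_map[OF fst compact S(3)])
    show "fst ` topspace Q = topspace S"
      using diag Q by (intro compact_image_contains_dense[OF fst compact S(3) _ dense(1)]) force
    have "b = c" if "(a, b) \<in> K" "(a, c) \<in> K" for a b c
      using common_approximation_unique[OF V W _ X(2) VW] T approx that K by blast
    then show "inj_on fst (topspace Q)" by (auto simp: Q inj_on_def)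
  qed
  then obtain g where g: "homeomorphic_maps Q S fst g"
    unfolding homeomorphic_map_maps by blast
  moreover have "homeomorphic_map Q T snd"
  proof (rule continuous_imp_homeomorphic_map[OF snd compact T(3)])
    show "snd ` topspace Q = topspace T"
      using diag Q by (intro compact_image_contains_dense[OF snd compact T(3) _ dense(2)]) force
    have "a = c" if ab: "(a, b) \<in> K" and cb: "(c, b) \<in> K" for a b c
    proof (rule common_approximation_unique[OF W V _ X(1) VW[symmetric], of a c b])
      show "\<exists>x\<in>X. (b, x) \<in> D \<and> (a, x) \<in> E" if "D \<in> W" "E \<in> V" for D E
        using approx[OF ab that(2,1)] by blast
      show "\<exists>x\<in>X. (b, x) \<in> D \<and> (c, x) \<in> E" if "D \<in> W" "E \<in> V" for D E
        using approx[OF cb that(2,1)] by blast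
    qed (use S K ab cb in auto)
    then show "inj_on snd (topspace Q)" by (auto simp: Q inj_on_def)
  qed
  ultimately have "homeomorphic_map S T (snd \<circ> g)"
    by (meson homeomorphic_map_compose homeomorphic_maps_map)
  moreover have "(snd \<circ> g) x = x" if "x \<in> X" for x
    using g diag[OF that] Q unfolding homeomorphic_maps_def by force
  ultimately show thesis using that by blast
qed

section \<open>Completions of graphs\<close>

lemma disjoint_closed_dense_parts:
  assumes "closedin T P" "closedin T Q" "P \<inter> Q = {}" "A \<subseteq> P" "B \<subseteq> Q"
    and dense: "T closure_of (A \<union> B) = topspace T"
  shows "T closure_of A = P" "T closure_of B = Q"
proof -
  have "T closure_of A \<subseteq> P" "T closure_of B \<subseteq> Q"
    using assms by (simp_all add: closure_of_minimal)
  moreover have "P \<union> Q \<subseteq> T closure_of A \<union> T closure_of B"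
    using assms(1,2) dense by (simp add: closedin_subset)
  ultimately show "T closure_of A = P" "T closure_of B = Q" using assms(3) by blast+
qed

lemma completion_verts_edges_closure:
  assumes "graph_completion G U H T"
  shows "T closure_of verts G = verts H" and "T closure_of edges G = edges H"
proof -
  have "closedin T (verts H)" "closedin T (edges H)" "verts H \<inter> edges H = {}"
    "verts G \<subseteq> verts H" "edges G \<subseteq> edges H"
    and "T closure_of (verts G \<union> edges G) = topspace T"
    using assms
    by (auto simp: graph_completion_def topological_graph_def subgraph_def is_graph_def points_def)
  from disjoint_closed_dense_parts[OF this]
  show "T closure_of verts G = verts H" and "T closure_of edges G = edges H" .
qed

text \<open>Both \<open>f \<circ> p\<close> and \<open>q \<circ> f\<close> are continuous into a Hausdorff space and agree on a dense set.\<close>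

lemma intertwines_on_closure:
  assumes f: "continuous_map S T f" and T: "Hausdorff_space T"
    and p: "continuous_map (subtopology S E) (subtopology S P) p"
    and q: "continuous_map (subtopology T F) (subtopology T Q) q"
    and fE: "f ` E \<subseteq> F" and E: "S closure_of D = E" "D \<subseteq> E"
    and eq: "\<And>e. e \<in> D \<Longrightarrow> f (p e) = q (f e)"
    and e: "e \<in> E"
  shows "f (p e) = q (f e)"
proof -
  have "continuous_map (subtopology S E) T (f \<circ> p)"
    using p f by (meson continuous_map_compose continuous_map_into_fulltopology)
  moreover have "continuous_map (subtopology S E) (subtopology T F) f"
    using f fE
    by (intro continuous_map_into_subtopology continuous_map_from_subtopology) auto
  then have "continuous_map (subtopology S E) T (q \<circ> f)"
    using q by (meson continuous_map_compose continuous_map_into_fulltopology)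
  moreover have "e \<in> subtopology S E closure_of D"
    using e E by (simp add: closure_of_subtopology Int_absorb1)
  ultimately have "(f \<circ> p) e = (q \<circ> f) e"
    using T eq by (intro forall_in_closure_of_eq[of e _ D T "f \<circ> p" "q \<circ> f"]) auto
  then show ?thesis by simp
qed

lemma homeomorphism_of_completions_graph_iso:
  assumes H: "graph_completion G U H S" and H': "graph_completion G U' H' T"
    and f: "homeomorphic_map S T f" and fixed: "\<And>x. x \<in> points G \<Longrightarrow> f x = x"
  shows "graph_iso H H' f"
proof -
  have cont: "continuous_map S T f" using f by (rule homeomorphic_imp_continuous_map)
  have "f ` verts G = verts G" "f ` edges G = edges G"
    using fixed by (force simp: points_def)+
  then have fV: "f ` verts H \<subseteq> verts H'" and fE: "f ` edges H \<subseteq> edges H'"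
    using continuous_map_image_closure_subset[OF cont, of "verts G"]
      continuous_map_image_closure_subset[OF cont, of "edges G"]
    by (simp_all add: completion_verts_edges_closure[OF H] completion_verts_edges_closure[OF H'])
  have T: "Hausdorff_space T" using H' by (simp add: graph_completion_def)
  have maps: "continuous_map (subtopology S (edges H)) (subtopology S (verts H)) (src H)"
    "continuous_map (subtopology S (edges H)) (subtopology S (verts H)) (tgt H)"
    "continuous_map (subtopology S (edges H)) (subtopology S (edges H)) (bar H)"
    "continuous_map (subtopology T (edges H')) (subtopology T (verts H')) (src H')"
    "continuous_map (subtopology T (edges H')) (subtopology T (verts H')) (tgt H')"
    "continuous_map (subtopology T (edges H')) (subtopology T (edges H')) (bar H')"
    using H H' by (simp_all add: graph_completion_def topological_graph_def)
  have sub: "subgraph G H" "subgraph G H'"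
    using H H' by (simp_all add: graph_completion_def)
  have D: "edges G \<subseteq> edges H" using sub by (simp add: subgraph_def)
  have closed: "src G e \<in> points G" "tgt G e \<in> points G" "bar G e \<in> points G"
    if "e \<in> edges G" for e
    using sub(1) that by (auto simp: subgraph_def is_graph_def points_def)
  have base: "f (src H e) = src H' (f e)" "f (tgt H e) = tgt H' (f e)" "f (bar H e) = bar H' (f e)"
    if e: "e \<in> edges G" for e
  proof -
    have "f e = e" using e fixed by (simp add: points_def)
    moreover have "src H e = src G e" "tgt H e = tgt G e" "bar H e = bar G e"
      "src H' e = src G e" "tgt H' e = tgt G e" "bar H' e = bar G e"
      using e sub by (simp_all add: subgraph_def)
    ultimately show "f (src H e) = src H' (f e)" "f (tgt H e) = tgt H' (f e)"
      "f (bar H e) = bar H' (f e)"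
      using fixed closed[OF e] by simp_all
  qed
  note extend = intertwines_on_closure
    [OF cont T _ _ fE completion_verts_edges_closure(2)[OF H] D]
  have "graph_map H H' f"
    unfolding graph_map_def
    using fV fE extend[OF maps(1,4) base(1)] extend[OF maps(2,5) base(2)]
      extend[OF maps(3,6) base(3)] by blast
  moreover have "points H = topspace S" "points H' = topspace T"
    using H H' by (simp_all add: graph_completion_def topological_graph_def)
  then have "bij_betw f (points H) (points H')"
    using f by (simp add: bij_betw_def homeomorphic_eq_everything_map)
  ultimately show ?thesis by (simp add: graph_iso_def)
qed

theorem corollary7p4:
  fixes \<Gamma> \<Gamma>\<^sub>0 \<Gamma>\<^sub>1 :: "'a sgraph"
    and U :: "('a \<times> 'a) set set"
    and T\<^sub>0 T\<^sub>1 :: "'a topology"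
  assumes "cofinite_graph \<Gamma> U"
    and "graph_completion \<Gamma> U \<Gamma>\<^sub>0 T\<^sub>0"
    and "graph_completion \<Gamma> U \<Gamma>\<^sub>1 T\<^sub>1"
  shows "\<exists>f. graph_iso \<Gamma>\<^sub>0 \<Gamma>\<^sub>1 f \<and> homeomorphic_map T\<^sub>0 T\<^sub>1 f \<and> (\<forall>x\<in>points \<Gamma>. f x = x)"
proof -
  obtain V where V: "uniform_structure (points \<Gamma>\<^sub>0) V" "uniform_topology (points \<Gamma>\<^sub>0) V = T\<^sub>0"
    "subspace_uniformity (points \<Gamma>) V = U"
    using assms(2) by (auto simp: graph_completion_def)
  obtain W where W: "uniform_structure (points \<Gamma>\<^sub>1) W" "uniform_topology (points \<Gamma>\<^sub>1) W = T\<^sub>1"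
    "subspace_uniformity (points \<Gamma>) W = U"
    using assms(3) by (auto simp: graph_completion_def)
  have "compact_space T\<^sub>0" "Hausdorff_space T\<^sub>0" "compact_space T\<^sub>1" "Hausdorff_space T\<^sub>1"
    "points \<Gamma> \<subseteq> points \<Gamma>\<^sub>0" "points \<Gamma> \<subseteq> points \<Gamma>\<^sub>1"
    "T\<^sub>0 closure_of points \<Gamma> = topspace T\<^sub>0" "T\<^sub>1 closure_of points \<Gamma> = topspace T\<^sub>1"
    using assms(2,3) by (auto simp: graph_completion_def subgraph_def points_def)
  then obtain f where f: "homeomorphic_map T\<^sub>0 T\<^sub>1 f" "\<And>x. x \<in> points \<Gamma> \<Longrightarrow> f x = x"
    using dense_uniform_subspace_homeomorphic
      [OF V(1) W(1) V(2)[symmetric] _ _ W(2)[symmetric], where X = "points \<Gamma>"] V(3) W(3)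
    by metis
  have "graph_iso \<Gamma>\<^sub>0 \<Gamma>\<^sub>1 f"
    using assms(2,3) f by (rule homeomorphism_of_completions_graph_iso)
  then show ?thesis using f by blast
qed

end
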